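(* Let $f:\mathbb{R}^n\to\mathbb{R}\cup\{\infty\}$ be a lower semicontinuous convex function which is proper (i.e. not identically $+\infty$). Suppose that the minimization problem $\min_{x\in\mathbb{R}^n}f(x)$ has a solution. Then any parallel Jacobi algorithm associated with the single-valued mapping $F=(I+\partial f)^{-1}:\mathbb{R}^n\to\mathbb{R}^n$ converges to a minimizer of $f$ in $\mathbb{R}^n$: for every $x^0\in\mathbb{R}^n$, the sequence defined by $$x_i^{p+1}=F_i(x_1^p,\dots,x_\alpha^p),\qquad i=1,\dots,\alpha,\quad p=0,1,2,\dots$$ converges to a minimizer of $f$.
   Context: Let $\alpha\ge1$ be an integer, $n=\sum_{i=1}^\alpha n_i$, and write $\mathbb{R}^n=\prod_{i=1}^\alpha\mathbb{R}^{n_i}$, with $x=(x_1,\dots,x_\alpha)$, $x_i\in\mathbb{R}^{n_i}$; $F_i:\mathbb{R}^n\to\mathbb{R}^{n_i}$ is the $i$-th block component of $F$. Each $\mathbb{R}^{n_i}$ carries an inner product $\langle\cdot,\cdot\rangle_i$ and $\mathbb{R}^n$ carries $\langle x,y\rangle=\sum_{i=1}^\alpha\langle x_i,y_i\rangle_i$. The subdifferential $\partial f$ is taken with respect to this inner product: $w\in\partial f(x)$ iff $f(x)$ is finite and $f(z)\ge f(x)+\langle w,z-x\rangle$ for all $z\in\mathbb{R}^n$. It is a maximal monotone operator, and $y=(I+\partial f)^{-1}x$ means $x\in y+\partial f(y)$; this mapping is single-valued and everywhere defined. *)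

theory Defs
  imports "HOL-Analysis.Analysis"
begin

text \<open>
  The product of the spaces \<open>\<real>\<^bsup>n\<^sub>i\<^esup>\<close> is \<open>real ^ 'n\<close> with a map \<open>blk :: 'n \<Rightarrow> 'a\<close> sending each
  coordinate to the index of its block. There are \<open>\<alpha> = CARD('a)\<close> blocks and the \<open>i\<close>-th one has
  size \<open>n\<^sub>i = card (blk -` {i})\<close>. The factor \<open>\<real>\<^bsup>n\<^sub>i\<^esup>\<close> is represented by the
  coordinate subspace \<open>block_space blk i\<close>, and \<open>x\<^sub>i\<close> by \<open>block blk i x\<close>.
\<close>

definition block_space :: "('n::finite \<Rightarrow> 'a::finite) \<Rightarrow> 'a \<Rightarrow> (real ^ 'n) set" where
  "block_space blk i = {x. \<forall>k. blk k \<noteq> i \<longrightarrow> x $ k = 0}"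

definition block :: "('n::finite \<Rightarrow> 'a::finite) \<Rightarrow> 'a \<Rightarrow> real ^ 'n \<Rightarrow> real ^ 'n" where
  "block blk i x = (\<chi> k. if blk k = i then x $ k else 0)"

definition inner_product_on :: "'v::real_vector set \<Rightarrow> ('v \<Rightarrow> 'v \<Rightarrow> real) \<Rightarrow> bool" where
  "inner_product_on V ip \<longleftrightarrow>
     (\<forall>x\<in>V. \<forall>y\<in>V. ip x y = ip y x) \<and>
     (\<forall>x\<in>V. \<forall>y\<in>V. \<forall>z\<in>V. ip (x + y) z = ip x z + ip y z) \<and>
     (\<forall>c. \<forall>x\<in>V. \<forall>y\<in>V. ip (c *\<^sub>R x) y = c * ip x y) \<and>
     (\<forall>x\<in>V. x \<noteq> 0 \<longrightarrow> ip x x > 0)"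

definition block_inner ::
    "('n::finite \<Rightarrow> 'a::finite) \<Rightarrow> ('a \<Rightarrow> real ^ 'n \<Rightarrow> real ^ 'n \<Rightarrow> real) \<Rightarrow> real ^ 'n \<Rightarrow> real ^ 'n \<Rightarrow> real"
  where "block_inner blk ip x y = (\<Sum>i\<in>UNIV. ip i (block blk i x) (block blk i y))"

definition lsc :: "('v::topological_space \<Rightarrow> ereal) \<Rightarrow> bool" where
  "lsc f \<longleftrightarrow> (\<forall>x. f x \<le> Liminf (at x) f)"

text \<open>
  The weights are strictly positive, so that no product \<open>0 * \<infinity>\<close> occurs.
\<close>

definition convex_ereal :: "('v::real_vector \<Rightarrow> ereal) \<Rightarrow> bool" where
  "convex_ereal f \<longleftrightarrow>
     (\<forall>x y. \<forall>u>0. \<forall>v>0. u + v = 1 \<longrightarrow> f (u *\<^sub>R x + v *\<^sub>R y) \<le> ereal u * f x + ereal v * f y)"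

definition subdifferential :: "('v::real_vector \<Rightarrow> 'v \<Rightarrow> real) \<Rightarrow> ('v \<Rightarrow> ereal) \<Rightarrow> 'v \<Rightarrow> 'v set" where
  "subdifferential ip f x = {w. \<bar>f x\<bar> \<noteq> \<infinity> \<and> (\<forall>z. f z \<ge> f x + ereal (ip w (z - x)))}"

text \<open>
  \<open>resolvent T\<close> is the single-valued mapping \<open>(I + T)\<^sup>-\<^sup>1\<close>. It is meaningful only when
  \<open>x \<in> y + T y\<close> has exactly one solution \<open>y\<close> for every \<open>x\<close>, as is the case for the
  subdifferential of a proper lower semicontinuous convex function.
\<close>

definition resolvent :: "('v::real_vector \<Rightarrow> 'v set) \<Rightarrow> 'v \<Rightarrow> 'v" where
  "resolvent T x = (THE y. \<exists>w\<in>T y. x = y + w)"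

definition parallel_jacobi ::
    "('n::finite \<Rightarrow> 'a::finite) \<Rightarrow> (real ^ 'n \<Rightarrow> real ^ 'n) \<Rightarrow> (nat \<Rightarrow> real ^ 'n) \<Rightarrow> bool" where
  "parallel_jacobi blk F x \<longleftrightarrow> (\<forall>p i. block blk i (x (Suc p)) = block blk i (F (x p)))"

end

theory Submission
  imports Defs
begin

text \<open>
  Updating all blocks simultaneously is one application of \<open>F\<close>, so the algorithm is the proximal
  point iteration for the inner product \<open>block_inner blk ip\<close>. Here \<open>F x\<close> is the minimizer of
  \<open>f z + \<parallel>z - x\<parallel>\<^sup>2 / 2\<close>. The subgradient inequality at \<open>F x\<close> shows
  that for every minimizer \<open>s\<close>
  \<open>\<parallel>F x - s\<parallel>\<^sup>2 + 2 (f (F x) - f s) \<le> \<parallel>x - s\<parallel>\<^sup>2\<close>.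
  So the distance to \<open>s\<close> decreases along the iteration, and by telescoping the values of \<open>f\<close> tend
  to the minimum. By lower semicontinuity a cluster point of the iterates is a minimizer, and
  monotonicity of the distance to that cluster point makes the whole sequence converge to it.
\<close>

text \<open>A real strictly between \<open>c\<close> and \<open>f l\<close> would be exceeded by
  \<open>f\<close> near \<open>l\<close>, whereas \<open>f (s n) \<le> r n\<close> eventually falls
  below it. The real bounds \<open>r\<close> let continuous terms be moved to the right-hand
  side.\<close>

lemma lsc_le_limit:
  fixes f :: "'v::topological_space \<Rightarrow> ereal"
  assumes "lsc f" and s: "s \<longlonglongrightarrow> l" and le: "\<And>n. f (s n) \<le> ereal (r n)" and r: "r \<longlonglongrightarrow> c"
  shows "f l \<le> ereal c"
proof (rule ccontr)
  assume "\<not> f l \<le> ereal c"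
  then obtain d where d: "ereal c < ereal d" "ereal d < f l"
    using ereal_dense2[of "ereal c" "f l"] by (meson not_le)
  have "ereal d < Liminf (at l) f"
    using assms(1) d(2) unfolding lsc_def by (meson less_le_trans)
  then have "\<forall>\<^sub>F y in at l. ereal d < f y"
    by (rule less_LiminfD)
  \<comment> \<open>\<open>Liminf (at l)\<close> ignores the point \<open>l\<close>;
    \<open>d < f l\<close> fills it in, so \<open>s\<close> may take the value
    \<open>l\<close>.\<close>
  then have "\<forall>\<^sub>F y in nhds l. ereal d < f y"
    using d(2) by (auto simp: eventually_at_filter elim: eventually_mono)
  then have "\<forall>\<^sub>F n in sequentially. ereal d < f (s n)"
    using s by (rule eventually_compose_filterlim)
  moreover have "\<forall>\<^sub>F n in sequentially. r n < d"
    using order_tendstoD(2)[OF r] d(1) by simp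
  ultimately have "\<forall>\<^sub>F n in sequentially. False"
  proof eventually_elim
    case (elim n)
    then show False
      using le[of n] by (metis ereal_less_eq(3) leD less_le_trans order.strict_iff_order)
  qed
  then show False by simp
qed

locale proximal_point =
  fixes B :: "'v::euclidean_space \<Rightarrow> 'v \<Rightarrow> real" and f :: "'v \<Rightarrow> ereal"
  assumes inner_product: "inner_product_on UNIV B"
    and not_MInf: "f y \<noteq> -\<infinity>"
    and lsc: "lsc f"
    and convex: "convex_ereal f"
    and proper: "\<exists>y. f y \<noteq> \<infinity>"
    and attained: "\<exists>y. is_arg_min f (\<lambda>_. True) y"
begin

section \<open>The inner product \<open>B\<close> and the Euclidean topology\<close>

lemma sym: "B x y = B y x"
  and add_left: "B (x + y) z = B x z + B y z"
  and scale_left: "B (c *\<^sub>R x) y = c * B x y"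
  and pos: "x \<noteq> 0 \<Longrightarrow> 0 < B x x"
  using inner_product by (auto simp: inner_product_on_def)

lemma add_right: "B z (x + y) = B z x + B z y"
  using sym add_left by metis

lemma scale_right: "B x (c *\<^sub>R y) = c * B x y"
  using sym scale_left by metis

text \<open>Bilinear maps in finite dimension are bounded. The sublocale below then supplies
  continuity and limit rules for \<open>B\<close>.\<close>

lemma bounded_bilinear_B: "bounded_bilinear B"
  by (simp add: bilinear_conv_bounded_bilinear[symmetric] bilinear_def linear_iff
      add_left add_right scale_left scale_right)

sublocale B: bounded_bilinear B
  by (rule bounded_bilinear_B)

lemma nonneg: "0 \<le> B x x"
  using pos[of x] by (cases "x = 0") (auto simp: B.zero_left)

lemma expand_add: "B (x + y) (x + y) = B x x + 2 * B x y + B y y"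
  using sym[of y x] by (simp add: add_left add_right)

text \<open>The quadratic form attains its minimum on the compact unit sphere, where it is positive;
  homogeneity extends the bound to all vectors. Boundedness and convergence measured by
  \<open>B\<close> thereby carry over to \<open>norm\<close>.\<close>

lemma norm_bound: obtains c where "c > 0" "\<And>x. c * (norm x)\<^sup>2 \<le> B x x"
proof -
  have "\<exists>u\<in>sphere 0 1. \<forall>x\<in>sphere 0 1. B u u \<le> B x x"
    by (intro continuous_attains_inf B.continuous_on continuous_intros) auto
  then obtain u where u: "norm u = 1" "\<And>x. norm x = 1 \<Longrightarrow> B u u \<le> B x x"
    by auto
  show thesis
  proof
    show "B u u > 0" using u(1) by (intro pos) auto
    fix x :: 'v
    show "B u u * (norm x)\<^sup>2 \<le> B x x"
    proof (cases "x = 0")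
      case False
      then have "B u u \<le> B (x /\<^sub>R norm x) (x /\<^sub>R norm x)"
        by (intro u(2)) simp
      also have "\<dots> = B x x / (norm x)\<^sup>2"
        by (simp add: scale_left scale_right power2_eq_square field_simps)
      finally show ?thesis using False by (simp add: field_simps)
    qed (simp add: B.zero_left)
  qed
qed

lemma bounded_if:
  assumes "\<And>z. z \<in> S \<Longrightarrow> B (z - a) (z - a) \<le> K"
  shows "bounded S"
proof -
  obtain c where c: "c > 0" "\<And>x. c * (norm x)\<^sup>2 \<le> B x x" using norm_bound by blast
  have "norm (z - a) \<le> sqrt (K / c)" if "z \<in> S" for z
  proof (rule real_le_rsqrt)
    show "(norm (z - a))\<^sup>2 \<le> K / c"
      using c(2)[of "z - a"] assms[OF that] c(1) by (simp add: field_simps)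
  qed
  then have "\<forall>z\<in>S. dist a z \<le> sqrt (K / c)"
    by (simp add: dist_norm norm_minus_commute)
  then show ?thesis by (auto simp only: bounded_def)
qed

lemma convergent_subsequence:
  fixes z :: "nat \<Rightarrow> 'v"
  assumes "\<And>n. B (z n - a) (z n - a) \<le> K"
  obtains r l where "strict_mono r" "(\<lambda>n. z (r n)) \<longlonglongrightarrow> l"
proof -
  have "bounded (range z)"
    using assms by (intro bounded_if[of _ a K]) auto
  then have "\<exists>l r. strict_mono r \<and> (z \<circ> r) \<longlonglongrightarrow> l"
    using bounded_imp_convergent_subsequence by blast
  then show thesis using that by (auto simp: o_def)
qed

lemma tendsto_if:
  assumes "(\<lambda>n. B (z n - l) (z n - l)) \<longlonglongrightarrow> 0"
  shows "z \<longlonglongrightarrow> l"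
proof -
  obtain c where c: "c > 0" "\<And>x. c * (norm x)\<^sup>2 \<le> B x x" using norm_bound by blast
  have "(\<lambda>n. sqrt (B (z n - l) (z n - l) / c)) \<longlonglongrightarrow> sqrt (0 / c)"
    by (intro tendsto_intros assms) (use c in auto)
  then have "(\<lambda>n. sqrt (B (z n - l) (z n - l) / c)) \<longlonglongrightarrow> 0" by simp
  moreover have "norm (z n - l) \<le> sqrt (B (z n - l) (z n - l) / c)" for n
    using c(2)[of "z n - l"] c(1) by (intro real_le_rsqrt) (simp add: field_simps)
  ultimately have "(\<lambda>n. z n - l) \<longlonglongrightarrow> 0"
    by (metis (no_types, lifting) Lim_null_comparison always_eventually)
  then show ?thesis by (simp add: LIM_zero_iff)
qed

section \<open>Existence and optimality of proximal points\<close>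

lemma attained_real: obtains s m where "f s = ereal m" "\<And>z. ereal m \<le> f z"
proof -
  obtain s where s: "\<And>z. f s \<le> f z"
    using attained by (auto simp: is_arg_min_def not_less)
  obtain m where "f s = ereal m"
    using s proper not_MInf[of s] by (cases "f s") auto
  with s that show thesis by metis
qed

lemma is_arg_min_iff:
  assumes "f s = ereal m" "\<And>z. ereal m \<le> f z"
  shows "is_arg_min f (\<lambda>_. True) y \<longleftrightarrow> f y \<le> ereal m"
  unfolding is_arg_min_def not_less simp_thms using assms by (metis not_less order_trans)

text \<open>Direct method: a minimizing sequence is bounded because \<open>f\<close> is bounded
  below, and lower semicontinuity makes a cluster point a minimizer.\<close>

lemma prox_exists:
  obtains y where "\<And>z. f y + ereal (B (y - x) (y - x) / 2) \<le> f z + ereal (B (z - x) (z - x) / 2)"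
    and "\<bar>f y\<bar> \<noteq> \<infinity>"
proof -
  obtain s m where s: "f s = ereal m" and m: "\<And>z. ereal m \<le> f z" using attained_real by blast
  \<comment> \<open>Only finite values of the objective are collected, so that the infimum is a real
    number.\<close>
  define V where "V = {v. \<exists>z. f z + ereal (B (z - x) (z - x) / 2) = ereal v}"
  define I where "I = Inf V"
  have below: "m + B (z - x) (z - x) / 2 \<le> v" if "f z + ereal (B (z - x) (z - x) / 2) = ereal v" for z v
    using that m[of z] by (cases "f z") auto
  have bdd: "bdd_below V"
  proof (rule bdd_belowI)
    fix v assume "v \<in> V"
    then obtain z where "f z + ereal (B (z - x) (z - x) / 2) = ereal v" by (auto simp: V_def)
    from below[OF this] show "m \<le> v" using nonneg[of "z - x"] by simp
  qed
  have ne: "V \<noteq> {}" by (auto simp: V_def intro!: exI[of _ s] simp: s)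
  have "\<exists>z v. f z + ereal (B (z - x) (z - x) / 2) = ereal v \<and> v < I + inverse (real (Suc n))" for n
    using cInf_lessD[OF ne, of "I + inverse (real (Suc n))"] by (auto simp: I_def V_def)
  then obtain z v where zv: "\<And>n. f (z n) + ereal (B (z n - x) (z n - x) / 2) = ereal (v n)"
    and v: "\<And>n. v n < I + inverse (real (Suc n))" by metis
  \<comment> \<open>Combine \<open>m + B (z n - x) (z n - x) / 2 \<le> v n\<close> with
    \<open>v n < I + 1\<close>.\<close>
  have "B (z n - x) (z n - x) \<le> 2 * (I + 1 - m)" for n
  proof -
    have "inverse (real (Suc n)) \<le> 1" by (simp add: field_simps)
    then show ?thesis using below[OF zv[of n]] v[of n] by (smt (verit) field_sum_of_halves)
  qed
  then obtain r y where r: "strict_mono r" and y: "(\<lambda>n. z (r n)) \<longlonglongrightarrow> y"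
    by (rule convergent_subsequence[of z x])
  have fy: "f y \<le> ereal (I + 0 - B (y - x) (y - x) / 2)"
  proof (rule lsc_le_limit[OF lsc y])
    show "f (z (r n)) \<le> ereal (I + inverse (real (Suc (r n))) - B (z (r n) - x) (z (r n) - x) / 2)" for n
      using zv[of "r n"] v[of "r n"] by (cases "f (z (r n))") auto
    have "(\<lambda>n. inverse (real (Suc (r n)))) \<longlonglongrightarrow> 0"
      using LIMSEQ_subseq_LIMSEQ[OF LIMSEQ_inverse_real_of_nat r] by (simp add: o_def)
    then show "(\<lambda>n. I + inverse (real (Suc (r n))) - B (z (r n) - x) (z (r n) - x) / 2)
        \<longlonglongrightarrow> I + 0 - B (y - x) (y - x) / 2"
      by (intro tendsto_intros B.tendsto y) auto
  qed
  show thesis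
  proof
    show "\<bar>f y\<bar> \<noteq> \<infinity>" using fy m[of y] by auto
    show "f y + ereal (B (y - x) (y - x) / 2) \<le> f w + ereal (B (w - x) (w - x) / 2)" for w
    proof (cases "f w")
      case (real a)
      then have "I \<le> a + B (w - x) (w - x) / 2"
        unfolding I_def using bdd by (intro cInf_lower) (auto simp: V_def intro!: exI[of _ w])
      then show ?thesis using fy real by (cases "f y") auto
    qed (use not_MInf in auto)
  qed
qed

text \<open>First-order optimality: compare \<open>y\<close> with points on the segment towards
  \<open>z\<close>, bound \<open>f\<close> there by convexity, divide by the step length
  \<open>t\<close> and let \<open>t\<close> tend to 0 from the right.\<close>

lemma subgradient_if_prox:
  assumes min: "\<And>z. f y + ereal (B (y - x) (y - x) / 2) \<le> f z + ereal (B (z - x) (z - x) / 2)"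
    and fin: "\<bar>f y\<bar> \<noteq> \<infinity>"
  shows "x - y \<in> subdifferential B f y"
proof -
  obtain b where b: "f y = ereal b" using fin by auto
  have "f y + ereal (B (x - y) (z - y)) \<le> f z" for z
  proof (cases "f z")
    case (real a)
    have ineq: "b + B (x - y) (z - y) - a \<le> t * (B (z - y) (z - y) / 2)" if t: "0 < t" "t < 1" for t
    proof -
      define w where "w = (1 - t) *\<^sub>R y + t *\<^sub>R z"
      have "f w \<le> ereal (1 - t) * f y + ereal t * f z"
        using convex t unfolding w_def convex_ereal_def by auto
      then have fw: "f w \<le> ereal ((1 - t) * b + t * a)" by (simp add: b real)
      have "w - x = (y - x) + t *\<^sub>R (z - y)" by (simp add: w_def algebra_simps)
      then have "B (w - x) (w - x) = B (y - x) (y - x) + 2 * (t * B (y - x) (z - y)) + t * (t * B (z - y) (z - y))"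
        by (simp only: expand_add scale_left scale_right)
      moreover have "b + B (y - x) (y - x) / 2 \<le> (1 - t) * b + t * a + B (w - x) (w - x) / 2"
        using min[of w] fw b by (cases "f w") auto
      ultimately have "t * (b - B (y - x) (z - y) - a) \<le> t * (t * (B (z - y) (z - y) / 2))"
        by (simp add: field_simps)
      then have "b - B (y - x) (z - y) - a \<le> t * (B (z - y) (z - y) / 2)"
        using t by simp
      moreover have "B (x - y) (z - y) = - B (y - x) (z - y)"
        by (metis B.minus_left minus_diff_eq)
      ultimately show ?thesis by simp
    qed
    have "((\<lambda>t. t * (B (z - y) (z - y) / 2)) \<longlongrightarrow> 0 * (B (z - y) (z - y) / 2)) (at_right 0)"
      by (intro tendsto_intros)
    moreover have "\<forall>\<^sub>F t in at_right 0. b + B (x - y) (z - y) - a \<le> t * (B (z - y) (z - y) / 2)"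
      using ineq by (auto simp: eventually_at_right_field intro!: exI[of _ 1])
    ultimately have "b + B (x - y) (z - y) - a \<le> 0 * (B (z - y) (z - y) / 2)"
      by (rule tendsto_lowerbound) simp
    then show ?thesis by (simp add: b real)
  qed (use not_MInf in auto)
  then show ?thesis using fin by (simp add: subdifferential_def)
qed

section \<open>Monotonicity and the resolvent\<close>

lemma subdifferential_monotone:
  assumes "u \<in> subdifferential B f y" "v \<in> subdifferential B f z"
  shows "0 \<le> B (u - v) (y - z)"
proof -
  obtain a b where ab: "f y = ereal a" "f z = ereal b"
    using assms by (auto simp: subdifferential_def)
  have "f y + ereal (B u (z - y)) \<le> f z" "f z + ereal (B v (y - z)) \<le> f y"
    using assms by (auto simp: subdifferential_def)
  \<comment> \<open>Adding the two subgradient inequalities cancels the finite values of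
    \<open>f\<close>.\<close>
  then have "B u (z - y) + B v (y - z) \<le> 0" by (simp add: ab)
  moreover have "B u (z - y) = - B u (y - z)"
    by (metis B.minus_right minus_diff_eq)
  ultimately show ?thesis by (simp add: B.diff_left)
qed

text \<open>The \<open>THE\<close> in \<open>resolvent\<close> is well defined: a proximal point is
  a solution, and for two solutions \<open>y\<close> and \<open>z\<close> monotonicity gives
  \<open>B (y - z) (y - z) \<le> 0\<close>.\<close>

lemma resolvent_subgradient:
  "x - resolvent (subdifferential B f) x \<in> subdifferential B f (resolvent (subdifferential B f) x)"
proof -
  have "\<exists>!y. \<exists>w\<in>subdifferential B f y. x = y + w"
  proof (rule ex_ex1I)
    show "\<exists>y. \<exists>w\<in>subdifferential B f y. x = y + w"
    proof -
      obtain y where "x - y \<in> subdifferential B f y"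
        using prox_exists[of x] subgradient_if_prox by metis
      then show ?thesis by (intro exI[of _ y] bexI[of _ "x - y"]) auto
    qed
    fix y z
    assume "\<exists>w\<in>subdifferential B f y. x = y + w" "\<exists>w\<in>subdifferential B f z. x = z + w"
    then have "0 \<le> B ((x - y) - (x - z)) (y - z)"
      by (intro subdifferential_monotone) (metis add_diff_cancel_left')+
    also have "(x - y) - (x - z) = - (y - z)" by simp
    finally have "B (y - z) (y - z) \<le> 0" by (simp only: B.minus_left)
    then show "y = z" using pos[of "y - z"] by force
  qed
  from theI'[OF this, folded resolvent_def] show ?thesis
    by (metis add_diff_cancel_left')
qed

section \<open>Descent and convergence of the iteration\<close>

lemma prox_step:
  assumes "x - y \<in> subdifferential B f y" and "f s = ereal m"
  obtains b where "f y = ereal b" "B (y - s) (y - s) + 2 * (b - m) \<le> B (x - s) (x - s)"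
proof -
  obtain b where b: "f y = ereal b" using assms(1) by (auto simp: subdifferential_def)
  have "f y + ereal (B (x - y) (s - y)) \<le> f s"
    using assms(1) by (simp add: subdifferential_def)
  then have "b - m \<le> - B (x - y) (s - y)" by (simp add: b assms(2))
  also have "\<dots> = B (x - y) (y - s)" by (metis B.minus_right minus_diff_eq)
  finally have "b - m \<le> B (x - y) (y - s)" .
  moreover have "B (x - s) (x - s) = B (x - y) (x - y) + 2 * B (x - y) (y - s) + B (y - s) (y - s)"
    using expand_add[of "x - y" "y - s"] by simp
  ultimately have "B (y - s) (y - s) + 2 * (b - m) \<le> B (x - s) (x - s)"
    using nonneg[of "x - y"] by smt
  with b show thesis by (rule that)
qed

theorem proximal_point_converges:
  assumes step: "\<And>p. x (Suc p) = resolvent (subdifferential B f) (x p)"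
  shows "\<exists>y. is_arg_min f (\<lambda>_. True) y \<and> x \<longlonglongrightarrow> y"
proof -
  obtain s m where s: "f s = ereal m" and m: "\<And>z. ereal m \<le> f z" using attained_real by blast
  note subgradient = resolvent_subgradient[of "x _", folded step]
  have "\<exists>b. f (x (Suc p)) = ereal b" for p
    using prox_step[OF subgradient s] by metis
  \<comment> \<open>The index is shifted because \<open>f (x 0)\<close> may be infinite.\<close>
  then obtain b where b: "\<And>p. f (x (Suc p)) = ereal (b p)" by metis
  have b_ge: "m \<le> b p" for p using m[of "x (Suc p)"] by (simp add: b)
  \<comment> \<open>Stated for every minimizer \<open>y\<close>: it is applied first to
    \<open>s\<close> and later to the cluster point \<open>l\<close>.\<close>
  have decrease: "B (x (Suc p) - y) (x (Suc p) - y) + 2 * (b p - m) \<le> B (x p - y) (x p - y)"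
    if "f y = ereal m" for p y
    using prox_step[OF subgradient that, of p] b[of p] by auto
  have dec: "decseq (\<lambda>p. B (x p - y) (x p - y))" if "f y = ereal m" for y
    using decrease[OF that] b_ge by (intro decseq_SucI) (smt (verit))
  \<comment> \<open>Telescoping bounds the sums of the nonnegative gaps \<open>b p - m\<close>,
    which must therefore tend to 0.\<close>
  have partial: "(\<Sum>p<n. b p - m) \<le> B (x 0 - s) (x 0 - s) / 2 - B (x n - s) (x n - s) / 2" for n
  proof (induction n)
    case (Suc n)
    then show ?case using decrease[OF s, of n] by simp
  qed simp
  have "summable (\<lambda>p. b p - m)"
  proof (rule summableI_nonneg_bounded)
    show "(\<Sum>p<n. b p - m) \<le> B (x 0 - s) (x 0 - s) / 2" for n
      using partial[of n] nonneg[of "x n - s"] by linarith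
  qed (use b_ge in auto)
  then have b_lim: "b \<longlonglongrightarrow> m"
    using summable_LIMSEQ_zero LIM_zero_iff by blast
  have "B (x (Suc n) - s) (x (Suc n) - s) \<le> B (x 0 - s) (x 0 - s)" for n
    using dec[OF s] by (simp add: decseq_def)
  then obtain r l where r: "strict_mono r" and l: "(\<lambda>n. x (Suc (r n))) \<longlonglongrightarrow> l"
    by (rule convergent_subsequence)
  have fl: "f l \<le> ereal m"
  proof (rule lsc_le_limit[OF lsc l])
    show "f (x (Suc (r n))) \<le> ereal (b (r n))" for n by (simp add: b)
    show "(\<lambda>n. b (r n)) \<longlonglongrightarrow> m" using LIMSEQ_subseq_LIMSEQ[OF b_lim r] by (simp add: o_def)
  qed
  let ?q = "\<lambda>p. B (x p - l) (x p - l)"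
  have "decseq ?q" using dec fl m by (simp add: antisym)
  then obtain L where L: "?q \<longlonglongrightarrow> L"
    using decseq_convergent[of ?q 0] nonneg by blast
  \<comment> \<open>The limit \<open>L\<close> of the whole sequence of distances is found along
    this subsequence, where the iterates tend to \<open>l\<close>.\<close>
  have "strict_mono (\<lambda>n. Suc (r n))" using r by (simp add: strict_mono_def)
  from LIMSEQ_subseq_LIMSEQ[OF L this] have "(\<lambda>n. ?q (Suc (r n))) \<longlonglongrightarrow> L" by (simp add: o_def)
  moreover have "(\<lambda>n. ?q (Suc (r n))) \<longlonglongrightarrow> B (l - l) (l - l)"
    by (intro B.tendsto tendsto_intros l)
  ultimately have "L = 0" using LIMSEQ_unique by (fastforce simp: B.zero_left)
  with L have "x \<longlonglongrightarrow> l" by (intro tendsto_if) simp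
  then show ?thesis using is_arg_min_iff[OF s m] fl by blast
qed

end

section \<open>Blocks and the inner product on the product space\<close>

lemma block_in_block_space: "block blk i x \<in> block_space blk i"
  by (simp add: block_def block_space_def)

lemma block_add: "block blk i (x + y) = block blk i x + block blk i y"
  by (simp add: block_def vec_eq_iff)

lemma block_scale: "block blk i (c *\<^sub>R x) = c *\<^sub>R block blk i x"
  by (simp add: block_def vec_eq_iff)

lemma eq_if_blocks_eq:
  assumes "\<And>i. block blk i x = block blk i y"
  shows "x = y"
proof -
  have "x $ k = y $ k" for k
    using arg_cong[OF assms[of "blk k"], of "\<lambda>v. v $ k"] by (simp add: block_def)
  then show ?thesis by (simp add: vec_eq_iff)
qed

lemma inner_product_on_block_inner:
  fixes blk :: "'n::finite \<Rightarrow> 'a::finite"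
  assumes ip: "\<And>i. inner_product_on (block_space blk i) (ip i)"
  shows "inner_product_on UNIV (block_inner blk ip)"
  unfolding inner_product_on_def block_inner_def
proof (intro conjI ballI allI impI)
  note ip' = ip[unfolded inner_product_on_def] and mem = block_in_block_space
  fix x y z :: "real ^ 'n" and c :: real
  show "(\<Sum>i\<in>UNIV. ip i (block blk i x) (block blk i y)) = (\<Sum>i\<in>UNIV. ip i (block blk i y) (block blk i x))"
    using ip' mem by (intro sum.cong) blast+
  show "(\<Sum>i\<in>UNIV. ip i (block blk i (x + y)) (block blk i z)) =
      (\<Sum>i\<in>UNIV. ip i (block blk i x) (block blk i z)) + (\<Sum>i\<in>UNIV. ip i (block blk i y) (block blk i z))"
    unfolding sum.distrib[symmetric] block_add using ip' mem by (intro sum.cong) blast+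
  have scale: "ip i (c *\<^sub>R block blk i x) (block blk i y) = c * ip i (block blk i x) (block blk i y)" for i c y
    using ip' mem by blast
  then show "(\<Sum>i\<in>UNIV. ip i (block blk i (c *\<^sub>R x)) (block blk i y)) =
      c * (\<Sum>i\<in>UNIV. ip i (block blk i x) (block blk i y))"
    by (simp add: block_scale sum_distrib_left)
  have pos: "0 < ip i (block blk i x) (block blk i x)" if "block blk i x \<noteq> 0" for i
    using ip' mem that by blast
  \<comment> \<open>Some blocks of a nonzero \<open>x\<close> may vanish; they contribute 0 to the
    sum, while at least one block contributes a positive term.\<close>
  have zero: "ip i 0 (block blk i x) = 0" for i
    using scale[of i 0 x] by simp
  assume "x \<noteq> 0"
  then obtain j where "block blk j x \<noteq> 0"
    using eq_if_blocks_eq[of blk x 0] block_scale[of blk _ 0 0] by auto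
  with pos zero show "0 < (\<Sum>i\<in>UNIV. ip i (block blk i x) (block blk i x))"
    by (intro sum_pos2[of _ j]) (auto, metis order.refl less_imp_le)
qed

theorem corollary5:
  fixes blk :: "'n::finite \<Rightarrow> 'a::finite"
    and ip :: "'a \<Rightarrow> real ^ 'n \<Rightarrow> real ^ 'n \<Rightarrow> real"
    and f :: "real ^ 'n \<Rightarrow> ereal"
    and x0 :: "real ^ 'n"
    and x :: "nat \<Rightarrow> real ^ 'n"
  assumes "\<And>i. inner_product_on (block_space blk i) (ip i)"
    and "\<And>y. f y \<noteq> -\<infinity>"
    and "lsc f"
    and "convex_ereal f"
    and "\<exists>y. f y \<noteq> \<infinity>"
    and "\<exists>y. is_arg_min f (\<lambda>_. True) y"
    and "x 0 = x0"
    and "parallel_jacobi blk (resolvent (subdifferential (block_inner blk ip) f)) x"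
  shows "\<exists>y. is_arg_min f (\<lambda>_. True) y \<and> x \<longlonglongrightarrow> y"
proof -
  interpret proximal_point "block_inner blk ip" f
    using assms inner_product_on_block_inner by unfold_locales blast+
  show ?thesis
  proof (rule proximal_point_converges)
    \<comment> \<open>The blockwise equations of \<open>parallel_jacobi\<close> combine into one
      vector equation, since a vector is determined by its blocks.\<close>
    show "x (Suc p) = resolvent (subdifferential (block_inner blk ip) f) (x p)" for p
      using assms(8) eq_if_blocks_eq unfolding parallel_jacobi_def by blast
  qed
qed

end
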